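(* Let $K\in\mathcal{M}_n(\mathbb{R})$ be a DPP kernel, let $X\sim\mathrm{DPP}(K)$ and let $M=I_n-2K$. Let $S_1,\dots,S_k$ be disjoint subsets of $[n]$, and define $R_i=(-1)^{|X\cap S_i|}$ for $i=1,\dots,k$, so that $R_i=1$ if $|X\cap S_i|$ is even and $R_i=-1$ if $|X\cap S_i|$ is odd. Then, for all $\epsilon\in\{-1,+1\}^k$, \[\mathbb{P}(\forall i\in[k],\ R_i=\epsilon_i)=\frac{1}{2^k}\sum_{T\subset[k]}\left(\prod_{i\in T}\epsilon_i\right)\det\big(M_{\cup_{i\in T}S_i}\big).\]
   Context: $[n]=\{1,\dots,n\}$; $\mathcal{M}_n(\mathbb{R})$ is the set of real $n\times n$ matrices; $I_n$ is the identity matrix. For a matrix $A$ and $S\subset[n]$, $A_S$ is the principal submatrix of $A$ with rows and columns indexed by $S$, with $\det(A_\emptyset)=1$. The determinantal measure with kernel $K$ is the unique signed measure $\mu$ on the power set $\mathcal{P}([n])$ such that $\mu(\{X\in\mathcal{P}([n]): S\subset X\})=\det(K_S)$ for all $S\subset[n]$. $K$ is called a DPP kernel if this $\mu$ is a probability measure; then $X\sim\mathrm{DPP}(K)$ means that $X$ is a random subset of $[n]$ with law $\mu$. The matrix $M=I_n-2K$ is called the parity kernel of the DPP. Kernels are not assumed symmetric. *)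

theory Defs
  imports "HOL-Probability.Probability_Measure" "Jordan_Normal_Form.Determinant"
    "Jordan_Normal_Form.DL_Submatrix"
begin

text \<open>
  Matrices are indexed from \<open>0\<close>, so the ground set \<open>[n]\<close> is \<open>{..<n}\<close>. The principal
  submatrix \<open>A\<^sub>S\<close> is \<open>submatrix A S S\<close>; the \<open>0 \<times> 0\<close> matrix has determinant \<open>1\<close>.
\<close>

text \<open>
  Since the power set of \<open>{..<n}\<close> is finite, a signed measure on it is a finitely additive
  real-valued set function. The \<open>extensional\<close> condition only fixes the irrelevant values of
  \<open>\<mu>\<close> outside its domain.
\<close>

definition is_determinantal_measure :: "nat \<Rightarrow> real mat \<Rightarrow> (nat set set \<Rightarrow> real) \<Rightarrow> bool" where
  "is_determinantal_measure n K \<mu> \<longleftrightarrow>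
     \<mu> \<in> extensional (Pow (Pow {..<n})) \<and> additive (Pow (Pow {..<n})) \<mu> \<and>
     (\<forall>S \<subseteq> {..<n}. \<mu> {X \<in> Pow {..<n}. S \<subseteq> X} = Determinant.det (submatrix K S S))"

lemma additive_Pow_eq_sum_singletons:
  fixes \<mu> :: "'a set \<Rightarrow> real"
  assumes add: "additive (Pow \<Omega>) \<mu>" and "finite A" "A \<subseteq> \<Omega>"
  shows "\<mu> A = (\<Sum>x\<in>A. \<mu> {x})"
  using \<open>finite A\<close> \<open>A \<subseteq> \<Omega>\<close>
proof (induction A rule: finite_induct)
  case empty
  have "\<mu> ({} \<union> {}) = \<mu> {} + \<mu> {}"
    using add unfolding additive_def by blast
  then show ?case by simp
next
  case (insert x F)
  have "\<mu> ({x} \<union> F) = \<mu> {x} + \<mu> F"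
    using add insert unfolding additive_def by blast
  then show ?case using insert by simp
qed

lemma determinantal_measure_ex: "\<exists>\<mu>. is_determinantal_measure n K \<mu>"
proof -
  let ?U = "{..<n}"
  define d where "d S = Determinant.det (submatrix K S S)" for S
  define h where "h T = (\<Sum>V\<in>Pow T. (-1) ^ card V * d (?U - V))" for T
  define w where "w X = (-1) ^ card (?U - X) * h (?U - X)" for X
  define \<mu> where "\<mu> = restrict (\<lambda>A. \<Sum>X\<in>A. w X) (Pow (Pow ?U))"
  have inv: "d (?U - S) = (\<Sum>T\<in>Pow S. (-1) ^ card T * h T)" if "finite S" for S
    by (rule inclusion_exclusion_symmetric[where f = "\<lambda>S. d (?U - S)"])
       (use that in \<open>simp_all add: h_def\<close>)
  have "\<mu> {X \<in> Pow ?U. S \<subseteq> X} = d S" if S: "S \<subseteq> ?U" for S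
  proof -
    have "\<mu> {X \<in> Pow ?U. S \<subseteq> X} = (\<Sum>X | X \<in> Pow ?U \<and> S \<subseteq> X. w X)"
      unfolding \<mu>_def by (subst restrict_apply') auto
    also have "\<dots> = (\<Sum>T\<in>Pow (?U - S). (-1) ^ card T * h T)"
      by (rule sum.reindex_bij_witness[where i = "\<lambda>T. ?U - T" and j = "\<lambda>X. ?U - X"])
         (use S in \<open>auto simp: w_def double_diff\<close>)
    also have "\<dots> = d (?U - (?U - S))"
      by (rule inv[symmetric]) simp
    also have "?U - (?U - S) = S" using S by auto
    finally show ?thesis .
  qed
  moreover have "additive (Pow (Pow ?U)) \<mu>"
    unfolding additive_def
  proof (intro ballI impI)
    fix A B assume AB: "A \<in> Pow (Pow ?U)" "B \<in> Pow (Pow ?U)" "A \<inter> B = {}"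
    then have "finite A" "finite B"
      by (auto intro: finite_subset[of _ "Pow ?U"])
    then show "\<mu> (A \<union> B) = \<mu> A + \<mu> B"
      using AB by (simp add: \<mu>_def restrict_def sum.union_disjoint)
  qed
  moreover have "\<mu> \<in> extensional (Pow (Pow ?U))"
    by (simp add: \<mu>_def)
  ultimately show ?thesis
    unfolding is_determinantal_measure_def d_def by blast
qed

lemma determinantal_measure_unique:
  assumes \<mu>: "is_determinantal_measure n K \<mu>" and \<nu>: "is_determinantal_measure n K \<nu>"
  shows "\<mu> = \<nu>"
proof -
  let ?U = "{..<n}"
  note sums = additive_Pow_eq_sum_singletons[of "Pow ?U"]
  have add: "additive (Pow (Pow ?U)) \<mu>" "additive (Pow (Pow ?U)) \<nu>"
    using \<mu> \<nu> by (simp_all add: is_determinantal_measure_def)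
  have fin: "finite A" if "A \<subseteq> Pow ?U" for A
    using that by (rule finite_subset) simp
  have sing: "\<mu> {X} = \<nu> {X}" if "X \<subseteq> ?U" for X
    using that
  proof (induction "card (?U - X)" arbitrary: X rule: less_induct)
    case less
    let ?A = "{Y \<in> Pow ?U. X \<subseteq> Y}"
    have A: "finite ?A" "?A \<subseteq> Pow ?U" "X \<in> ?A"
      using less.prems by auto
    have "(\<Sum>Y\<in>?A. \<mu> {Y}) = (\<Sum>Y\<in>?A. \<nu> {Y})"
      using \<mu> \<nu> less.prems sums[OF add(1) A(1,2)] sums[OF add(2) A(1,2)]
      by (simp add: is_determinantal_measure_def)
    moreover have "(\<Sum>Y\<in>?A - {X}. \<mu> {Y}) = (\<Sum>Y\<in>?A - {X}. \<nu> {Y})"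
    proof (rule sum.cong[OF refl])
      fix Y assume Y: "Y \<in> ?A - {X}"
      then have "?U - Y \<subset> ?U - X" by auto
      then have "card (?U - Y) < card (?U - X)"
        by (intro psubset_card_mono) auto
      then show "\<mu> {Y} = \<nu> {Y}" using Y by (intro less.hyps) auto
    qed
    ultimately show ?case
      using sum.remove[OF A(1,3), of "\<lambda>Y. \<mu> {Y}"] sum.remove[OF A(1,3), of "\<lambda>Y. \<nu> {Y}"]
      by linarith
  qed
  show ?thesis
  proof (rule extensionalityI)
    show "\<mu> \<in> extensional (Pow (Pow ?U))" "\<nu> \<in> extensional (Pow (Pow ?U))"
      using \<mu> \<nu> by (simp_all add: is_determinantal_measure_def)
    fix A assume "A \<in> Pow (Pow ?U)"
    then have A: "A \<subseteq> Pow ?U" by simp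
    show "\<mu> A = \<nu> A"
      unfolding sums[OF add(1) fin[OF A] A] sums[OF add(2) fin[OF A] A]
      by (rule sum.cong[OF refl]) (use A sing in auto)
  qed
qed

lemma determinantal_measure_ex1: "\<exists>!\<mu>. is_determinantal_measure n K \<mu>"
  using determinantal_measure_ex determinantal_measure_unique by blast

definition determinantal_measure :: "nat \<Rightarrow> real mat \<Rightarrow> nat set set \<Rightarrow> real" where
  "determinantal_measure n K = (THE \<mu>. is_determinantal_measure n K \<mu>)"

lemma is_determinantal_measure_determinantal_measure:
  "is_determinantal_measure n K (determinantal_measure n K)"
  unfolding determinantal_measure_def by (rule theI'[OF determinantal_measure_ex1])

text \<open>
  A DPP kernel is one whose signed measure is a probability measure, i.e. nonnegative with
  total mass \<open>1\<close>.
\<close>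

definition is_DPP_kernel :: "nat \<Rightarrow> real mat \<Rightarrow> bool" where
  "is_DPP_kernel n K \<longleftrightarrow> K \<in> carrier_mat n n \<and>
     (\<forall>A \<subseteq> Pow {..<n}. 0 \<le> determinantal_measure n K A) \<and>
     determinantal_measure n K (Pow {..<n}) = 1"

definition distributed_DPP :: "'w measure \<Rightarrow> ('w \<Rightarrow> nat set) \<Rightarrow> nat \<Rightarrow> real mat \<Rightarrow> bool" where
  "distributed_DPP P X n K \<longleftrightarrow> X \<in> measurable P (count_space (Pow {..<n})) \<and>
     (\<forall>A \<subseteq> Pow {..<n}. \<P>(\<omega> in P. X \<omega> \<in> A) = determinantal_measure n K A)"

definition parity_kernel :: "nat \<Rightarrow> real mat \<Rightarrow> real mat" where
  "parity_kernel n K = 1\<^sub>m n - 2 \<cdot>\<^sub>m K"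

end

theory Submission
  imports Defs
begin

text \<open>
  The event that the parities of the \<open>|X \<inter> S\<^sub>i|\<close> are prescribed by \<open>\<epsilon>\<close> has indicator
  \<open>\<Prod>i<k. (1 + \<epsilon>\<^sub>i R\<^sub>i) / 2\<close>, because \<open>\<epsilon>\<^sub>i R\<^sub>i\<close> is \<open>1\<close> when the two signs agree and \<open>-1\<close> otherwise.
  Expanding the product over \<open>T \<subseteq> [k]\<close>, and using that the \<open>S\<^sub>i\<close> are disjoint to merge
  \<open>\<Prod>i\<in>T. R\<^sub>i\<close> into the single sign \<open>(-1)^|X \<inter> (\<Union>i\<in>T. S\<^sub>i)|\<close>, reduces the claim to
  \<open>E (-1)^|X \<inter> W| = det M\<^sub>W\<close> for every \<open>W \<subseteq> [n]\<close> (lemma \<open>determinantal_expectation_parity\<close>).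

  For this, \<open>(-1)^|X \<inter> W| = \<Prod>x\<in>W. (1 - 2 [x \<in> X]) = \<Sum>V\<subseteq>W. (-2)^|V| [V \<subseteq> X]\<close>, so the expectation is
  \<open>\<Sum>V\<subseteq>W. (-2)^|V| det K\<^sub>V = \<Sum>V\<subseteq>W. det (-2K)\<^sub>V\<close>. This sum of principal minors is \<open>det (I - 2K)\<^sub>W\<close>
  (lemma \<open>det_submatrix_one_add\<close>): in the Leibniz formula for \<open>(I + A)\<^sub>W\<close>, choosing the identity
  entry in the rows outside \<open>V\<close> leaves exactly the permutations supported on \<open>V\<close>.
\<close>

section \<open>Principal minors\<close>

text \<open>
  Relabelling the rows and columns by the elements of \<open>S\<close> makes the Leibniz formulas of all the
  principal minors comparable, as sums over permutations of one common type.
\<close>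

lemma det_submatrix_eq_sum_permutes:
  fixes A :: "'a :: comm_ring_1 mat"
  assumes A: "A \<in> carrier_mat n n" and S: "S \<subseteq> {..<n}"
  shows "Determinant.det (submatrix A S S) =
    (\<Sum>p | p permutes S. of_int (sign p) * (\<Prod>i\<in>S. A $$ (i, p i)))"
proof -
  define m where "m = card S"
  define f where "f = pick S"
  have finS: "finite S" using S finite_subset by blast
  have dims: "{i. i < dim_row A \<and> i \<in> S} = S" "{i. i < dim_col A \<and> i \<in> S} = S"
    using A S by auto
  have carrier: "submatrix A S S \<in> carrier_mat m m"
    by (rule carrier_matI) (simp_all only: dim_submatrix dims m_def)
  have entry: "submatrix A S S $$ (i, j) = A $$ (f i, f j)" if "i < m" "j < m" for i j
    unfolding f_def by (rule submatrix_index) (use that in \<open>simp_all only: dims m_def\<close>)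
  have "inj_on f {0..<m}"
    by (rule inj_onI) (metis atLeastLessThan_iff card_pick f_def m_def)
  moreover have "f ` {0..<m} \<subseteq> S"
    by (auto simp: f_def m_def intro: pick_in_set)
  ultimately have bij: "bij_betw f {0..<m} S"
    unfolding bij_betw_def
    using finS card_image[of f "{0..<m}"] card_subset_eq[of S "f ` {0..<m}"]
    by (simp add: m_def)
  then have inj: "inj_on f {0..<m}" and image: "f ` {0..<m} = S"
    by (simp_all only: bij_betw_def)
  have "bij_betw (map_permutation {0..<m} f) {p. p permutes {0..<m}} {p. p permutes S}"
    using bij_betw_permutations[OF bij]
    by (simp only: map_permutation_def[abs_def] restrict_id_def image o_apply)
  then have "(\<Sum>p | p permutes S. of_int (sign p) * (\<Prod>i\<in>S. A $$ (i, p i))) =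
      (\<Sum>p | p permutes {0..<m}. of_int (sign (map_permutation {0..<m} f p)) *
        (\<Prod>i\<in>S. A $$ (i, map_permutation {0..<m} f p i)))"
    by (rule sum.reindex_bij_betw[symmetric])
  also have "\<dots> = (\<Sum>p | p permutes {0..<m}. signof p *
        (\<Prod>i = 0..<m. submatrix A S S $$ (i, p i)))"
  proof (rule sum.cong[OF refl])
    fix p assume "p \<in> {p. p permutes {0..<m}}"
    then have p: "p permutes {0..<m}" by simp
    have "(\<Prod>i\<in>S. A $$ (i, map_permutation {0..<m} f p i)) =
        (\<Prod>i = 0..<m. A $$ (f i, map_permutation {0..<m} f p (f i)))"
      by (rule prod.reindex_bij_betw[OF bij, symmetric])
    also have "\<dots> = (\<Prod>i = 0..<m. submatrix A S S $$ (i, p i))"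
    proof (rule prod.cong[OF refl])
      fix i assume i: "i \<in> {0..<m}"
      then have "p i \<in> {0..<m}" by (simp only: permutes_in_image[OF p])
      with i show "A $$ (f i, map_permutation {0..<m} f p (f i)) = submatrix A S S $$ (i, p i)"
        by (simp add: map_permutation_apply[OF inj] entry)
    qed
    finally show "of_int (sign (map_permutation {0..<m} f p)) *
        (\<Prod>i\<in>S. A $$ (i, map_permutation {0..<m} f p i)) =
        signof p * (\<Prod>i = 0..<m. submatrix A S S $$ (i, p i))"
      by (simp add: sign_map_permutation[OF inj p])
  qed
  also have "\<dots> = Determinant.det (submatrix A S S)"
    by (rule det_def'[OF carrier, symmetric])
  finally show ?thesis ..
qed

lemma det_submatrix_smult:
  fixes A :: "'a :: comm_ring_1 mat"
  assumes A: "A \<in> carrier_mat n n" and S: "S \<subseteq> {..<n}"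
  shows "Determinant.det (submatrix (c \<cdot>\<^sub>m A) S S) = c ^ card S * Determinant.det (submatrix A S S)"
proof -
  have cA: "c \<cdot>\<^sub>m A \<in> carrier_mat n n" using A by simp
  have "(\<Prod>i\<in>S. (c \<cdot>\<^sub>m A) $$ (i, p i)) = c ^ card S * (\<Prod>i\<in>S. A $$ (i, p i))"
    if p: "p permutes S" for p
  proof -
    have "(\<Prod>i\<in>S. (c \<cdot>\<^sub>m A) $$ (i, p i)) = (\<Prod>i\<in>S. c * A $$ (i, p i))"
    proof (rule prod.cong[OF refl])
      fix i assume i: "i \<in> S"
      then have "p i \<in> S" by (simp only: permutes_in_image[OF p])
      with i S A have "i < dim_row A" "p i < dim_col A" by auto
      then show "(c \<cdot>\<^sub>m A) $$ (i, p i) = c * A $$ (i, p i)" by simp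
    qed
    then show ?thesis by (simp add: prod.distrib)
  qed
  then show ?thesis
    unfolding det_submatrix_eq_sum_permutes[OF cA S] det_submatrix_eq_sum_permutes[OF A S]
    by (simp add: sum_distrib_left mult.left_commute)
qed

text \<open>
  Each factor of a Leibniz term of \<open>(1 + A)\<^sub>S\<close> is a sum of an entry of \<open>A\<close> and an entry of the
  identity. Taking the entries of \<open>A\<close> in the rows \<open>V\<close> and those of the identity in the other rows
  annihilates every permutation that moves a point outside \<open>V\<close>; the survivors are the
  permutations of \<open>V\<close>, with unchanged sign, and they add up to the minor of \<open>A\<close> on \<open>V\<close>.
\<close>

lemma det_submatrix_one_add:
  fixes A :: "'a :: comm_ring_1 mat"
  assumes A: "A \<in> carrier_mat n n" and S: "S \<subseteq> {..<n}"
  shows "Determinant.det (submatrix (1\<^sub>m n + A) S S) =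
    (\<Sum>V\<in>Pow S. Determinant.det (submatrix A V V))"
proof -
  define e where "e p i = (if p i = i then 1 else 0 :: 'a)" for p :: "nat \<Rightarrow> nat" and i
  have IA: "1\<^sub>m n + A \<in> carrier_mat n n" using A by simp
  have finS: "finite S" using S finite_subset by blast
  have expand: "(\<Prod>i\<in>S. (1\<^sub>m n + A) $$ (i, p i)) =
      (\<Sum>V\<in>Pow S. (\<Prod>i\<in>V. A $$ (i, p i)) * (\<Prod>i\<in>S - V. e p i))"
    if p: "p permutes S" for p
  proof -
    have "(\<Prod>i\<in>S. (1\<^sub>m n + A) $$ (i, p i)) = (\<Prod>i\<in>S. A $$ (i, p i) + e p i)"
    proof (rule prod.cong[OF refl])
      fix i assume i: "i \<in> S"
      then have "p i \<in> S" by (simp only: permutes_in_image[OF p])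
      with i S A have "i < n" "p i < n" "i < dim_row A" "p i < dim_col A" by auto
      then show "(1\<^sub>m n + A) $$ (i, p i) = A $$ (i, p i) + e p i"
        by (auto simp: e_def)
    qed
    also have "\<dots> = (\<Sum>V\<in>Pow S. (\<Prod>i\<in>V. A $$ (i, p i)) * (\<Prod>i\<in>S - V. e p i))"
      by (rule prod_add[OF finS])
    finally show ?thesis .
  qed
  have minor: "(\<Sum>p | p permutes S.
        of_int (sign p) * ((\<Prod>i\<in>V. A $$ (i, p i)) * (\<Prod>i\<in>S - V. e p i))) =
      Determinant.det (submatrix A V V)" if V: "V \<subseteq> S" for V
  proof -
    have V': "V \<subseteq> {..<n}" using V S by blast
    have "(\<Sum>p | p permutes V. of_int (sign p) * (\<Prod>i\<in>V. A $$ (i, p i))) =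
        (\<Sum>p | p permutes S.
          of_int (sign p) * ((\<Prod>i\<in>V. A $$ (i, p i)) * (\<Prod>i\<in>S - V. e p i)))"
    proof (rule sum.mono_neutral_cong_left)
      show "finite {p. p permutes S}" using finS by (rule finite_permutations)
      show "{p. p permutes V} \<subseteq> {p. p permutes S}"
        using permutes_subset[OF _ V] by blast
      show "\<forall>p\<in>{p. p permutes S} - {p. p permutes V}.
          of_int (sign p) * ((\<Prod>i\<in>V. A $$ (i, p i)) * (\<Prod>i\<in>S - V. e p i)) = 0"
      proof
        fix p assume "p \<in> {p. p permutes S} - {p. p permutes V}"
        then have "p permutes S" "\<not> p permutes V" by simp_all
        then obtain i where "i \<in> S - V" "p i \<noteq> i"
          using permutes_superset by metis
        then have "(\<Prod>i\<in>S - V. e p i) = 0"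
          using finS by (intro prod_zero) (auto simp: e_def)
        then show "of_int (sign p) * ((\<Prod>i\<in>V. A $$ (i, p i)) * (\<Prod>i\<in>S - V. e p i)) = 0"
          by simp
      qed
      fix p assume "p \<in> {p. p permutes V}"
      then have "(\<Prod>i\<in>S - V. e p i) = 1"
        by (intro prod.neutral) (auto simp: e_def permutes_not_in)
      then show "of_int (sign p) * (\<Prod>i\<in>V. A $$ (i, p i)) =
          of_int (sign p) * ((\<Prod>i\<in>V. A $$ (i, p i)) * (\<Prod>i\<in>S - V. e p i))"
        by simp
    qed
    then show ?thesis
      by (simp add: det_submatrix_eq_sum_permutes[OF A V'])
  qed
  have "Determinant.det (submatrix (1\<^sub>m n + A) S S) =
      (\<Sum>p | p permutes S. \<Sum>V\<in>Pow S.
        of_int (sign p) * ((\<Prod>i\<in>V. A $$ (i, p i)) * (\<Prod>i\<in>S - V. e p i)))"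
    unfolding det_submatrix_eq_sum_permutes[OF IA S]
    by (rule sum.cong[OF refl]) (simp add: expand sum_distrib_left)
  also have "\<dots> = (\<Sum>V\<in>Pow S. \<Sum>p | p permutes S.
        of_int (sign p) * ((\<Prod>i\<in>V. A $$ (i, p i)) * (\<Prod>i\<in>S - V. e p i)))"
    by (rule sum.swap)
  also have "\<dots> = (\<Sum>V\<in>Pow S. Determinant.det (submatrix A V V))"
    by (rule sum.cong[OF refl]) (simp add: minor)
  finally show ?thesis .
qed

lemma det_submatrix_parity_kernel:
  assumes K: "K \<in> carrier_mat n n" and W: "W \<subseteq> {..<n}"
  shows "Determinant.det (submatrix (parity_kernel n K) W W) =
    (\<Sum>V\<in>Pow W. (-2) ^ card V * Determinant.det (submatrix K V V))"
proof -
  have K': "(-2) \<cdot>\<^sub>m K \<in> carrier_mat n n" using K by simp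
  have "parity_kernel n K = 1\<^sub>m n + (-2) \<cdot>\<^sub>m K"
    unfolding parity_kernel_def using K by (intro eq_matI) auto
  moreover have "Determinant.det (submatrix ((-2) \<cdot>\<^sub>m K) V V) =
      (-2) ^ card V * Determinant.det (submatrix K V V)" if "V \<in> Pow W" for V
    using that W by (intro det_submatrix_smult[OF K]) auto
  ultimately show ?thesis
    by (simp add: det_submatrix_one_add[OF K' W])
qed

section \<open>Expected parity signs\<close>

text \<open>This is the product \<open>\<Prod>x\<in>W. (1 - 2 [x \<in> Y])\<close>, multiplied out.\<close>

lemma minus_one_power_card_Int:
  assumes "finite W"
  shows "(-1 :: 'a :: comm_ring_1) ^ card (Y \<inter> W) =
    (\<Sum>V\<in>Pow W. (-2) ^ card V * of_bool (V \<subseteq> Y))"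
proof -
  have "(-1 :: 'a) ^ card (Y \<inter> W) = (\<Prod>x\<in>W. if x \<in> Y then -1 else 1)"
    using assms by (simp add: prod.If_cases Int_commute)
  also have "\<dots> = (\<Prod>x\<in>W. (-2) * of_bool (x \<in> Y) + 1)"
    by (rule prod.cong) auto
  also have "\<dots> = (\<Sum>V\<in>Pow W. (\<Prod>x\<in>V. (-2) * of_bool (x \<in> Y)) * (\<Prod>x\<in>W - V. 1))"
    by (rule prod_add[OF assms])
  also have "\<dots> = (\<Sum>V\<in>Pow W. (-2) ^ card V * of_bool (V \<subseteq> Y))"
  proof (rule sum.cong[OF refl])
    fix V assume "V \<in> Pow W"
    then have "finite V" using assms finite_subset by blast
    then have "(\<Prod>x\<in>V. of_bool (x \<in> Y) :: 'a) = of_bool (V \<subseteq> Y)"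
      by (induction V rule: finite_induct) auto
    then show "(\<Prod>x\<in>V. (-2) * of_bool (x \<in> Y)) * (\<Prod>x\<in>W - V. 1) =
        (-2 :: 'a) ^ card V * of_bool (V \<subseteq> Y)"
      by (simp only: prod.distrib prod_constant) simp
  qed
  finally show ?thesis .
qed

lemma determinantal_measure_eq_sum_singletons:
  assumes "A \<subseteq> Pow {..<n}"
  shows "determinantal_measure n K A = (\<Sum>Y\<in>A. determinantal_measure n K {Y})"
  using is_determinantal_measure_determinantal_measure[of n K] assms
  unfolding is_determinantal_measure_def
  by (intro additive_Pow_eq_sum_singletons) (auto intro: finite_subset)

text \<open>
  The measure is only known through its inclusion masses \<open>\<mu> {Y. V \<subseteq> Y} = det K\<^sub>V\<close>. Expanding the
  sign into the indicators of \<open>V \<subseteq> Y\<close> turns the sum into a combination of these masses, which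
  \<open>det_submatrix_parity_kernel\<close> recognises as a minor of the parity kernel.
\<close>

lemma determinantal_expectation_parity:
  assumes K: "K \<in> carrier_mat n n" and W: "W \<subseteq> {..<n}"
  shows "(\<Sum>Y\<in>Pow {..<n}. determinantal_measure n K {Y} * (-1) ^ card (Y \<inter> W)) =
    Determinant.det (submatrix (parity_kernel n K) W W)"
proof -
  let ?\<mu> = "determinantal_measure n K"
  have finW: "finite W" using W finite_subset by blast
  have incl: "(\<Sum>Y\<in>Pow {..<n}. ?\<mu> {Y} * of_bool (V \<subseteq> Y)) = Determinant.det (submatrix K V V)"
    if V: "V \<subseteq> W" for V
  proof -
    have "(\<Sum>Y\<in>Pow {..<n}. ?\<mu> {Y} * of_bool (V \<subseteq> Y)) = (\<Sum>Y\<in>{Y \<in> Pow {..<n}. V \<subseteq> Y}. ?\<mu> {Y})"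
      by (rule sum.mono_neutral_cong_right) auto
    also have "\<dots> = ?\<mu> {Y \<in> Pow {..<n}. V \<subseteq> Y}"
      by (rule determinantal_measure_eq_sum_singletons[symmetric]) auto
    also have "\<dots> = Determinant.det (submatrix K V V)"
      using is_determinantal_measure_determinantal_measure[of n K] V W
      unfolding is_determinantal_measure_def by blast
    finally show ?thesis .
  qed
  have "(\<Sum>Y\<in>Pow {..<n}. ?\<mu> {Y} * (-1) ^ card (Y \<inter> W)) =
      (\<Sum>Y\<in>Pow {..<n}. \<Sum>V\<in>Pow W. (-2) ^ card V * (?\<mu> {Y} * of_bool (V \<subseteq> Y)))"
    unfolding minus_one_power_card_Int[OF finW] sum_distrib_left
    by (simp only: mult.left_commute)
  also have "\<dots> = (\<Sum>V\<in>Pow W. (-2) ^ card V * (\<Sum>Y\<in>Pow {..<n}. ?\<mu> {Y} * of_bool (V \<subseteq> Y)))"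
    unfolding sum_distrib_left by (rule sum.swap)
  also have "\<dots> = (\<Sum>V\<in>Pow W. (-2) ^ card V * Determinant.det (submatrix K V V))"
    by (rule sum.cong[OF refl]) (simp only: Pow_iff incl)
  finally show ?thesis
    by (simp add: det_submatrix_parity_kernel[OF K W])
qed

section \<open>Joint law of the parities of disjoint blocks\<close>

text \<open>
  Two signs \<open>a\<close>, \<open>b\<close> agree precisely when \<open>(1 + a b) / 2 = 1\<close> and differ precisely when it is \<open>0\<close>;
  the right-hand side is the product of these factors multiplied out.
\<close>

lemma of_bool_signs_agree:
  fixes a b :: "'i \<Rightarrow> real"
  assumes I: "finite I"
    and a: "\<And>i. i \<in> I \<Longrightarrow> a i \<in> {-1, 1}" and b: "\<And>i. i \<in> I \<Longrightarrow> b i \<in> {-1, 1}"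
  shows "of_bool (\<forall>i\<in>I. a i = b i) =
    1 / 2 ^ card I * (\<Sum>T\<in>Pow I. (\<Prod>i\<in>T. b i) * (\<Prod>i\<in>T. a i))"
proof -
  have "of_bool (\<forall>i\<in>I. a i = b i) = (\<Prod>i\<in>I. of_bool (a i = b i) :: real)"
    using I by (induction I rule: finite_induct) auto
  also have "\<dots> = (\<Prod>i\<in>I. (b i * a i + 1) / 2)"
  proof (rule prod.cong[OF refl])
    fix i assume "i \<in> I"
    from a[OF this] b[OF this] show "(of_bool (a i = b i) :: real) = (b i * a i + 1) / 2" by auto
  qed
  also have "\<dots> = 1 / 2 ^ card I * (\<Prod>i\<in>I. b i * a i + 1)"
    by (simp add: prod_dividef)
  also have "(\<Prod>i\<in>I. b i * a i + 1) = (\<Sum>T\<in>Pow I. (\<Prod>i\<in>T. b i) * (\<Prod>i\<in>T. a i))"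
    by (simp add: prod_add[OF I] prod.distrib)
  finally show ?thesis .
qed

lemma prod_minus_one_power_card_Int:
  assumes T: "finite T" and fin: "\<And>i. i \<in> T \<Longrightarrow> finite (S i)" and disj: "disjoint_family_on S T"
  shows "(\<Prod>i\<in>T. (-1 :: 'a :: comm_ring_1) ^ card (Y \<inter> S i)) = (-1) ^ card (Y \<inter> (\<Union>i\<in>T. S i))"
proof -
  have "card (Y \<inter> (\<Union>i\<in>T. S i)) = card (\<Union>i\<in>T. Y \<inter> S i)"
    by (simp only: Int_UN_distrib)
  also have "\<dots> = (\<Sum>i\<in>T. card (Y \<inter> S i))"
    using T fin disj by (intro card_UN_disjoint) (auto simp: disjoint_family_on_def)
  finally show ?thesis by (simp add: power_sum)
qed

theorem proposition3p3:
  fixes n k :: nat and K M :: "real mat"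
    and P :: "'w measure" and X :: "'w \<Rightarrow> nat set"
    and S :: "nat \<Rightarrow> nat set" and R :: "nat \<Rightarrow> 'w \<Rightarrow> real"
  assumes "is_DPP_kernel n K"
    and "prob_space P"
    and "distributed_DPP P X n K"
    and "M = parity_kernel n K"
    and "\<And>i. i < k \<Longrightarrow> S i \<subseteq> {..<n}"
    and "disjoint_family_on S {..<k}"
    and "\<And>i \<omega>. i < k \<Longrightarrow> R i \<omega> = (-1) ^ card (X \<omega> \<inter> S i)"
  shows "\<forall>\<epsilon> :: nat \<Rightarrow> real. (\<forall>i<k. \<epsilon> i \<in> {-1, 1}) \<longrightarrow>
    \<P>(\<omega> in P. \<forall>i<k. R i \<omega> = \<epsilon> i) =
      1 / 2 ^ k * (\<Sum>T\<in>Pow {..<k}.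
        (\<Prod>i\<in>T. \<epsilon> i) * Determinant.det (submatrix M (\<Union>i\<in>T. S i) (\<Union>i\<in>T. S i)))"
proof (intro allI impI)
  fix \<epsilon> :: "nat \<Rightarrow> real"
  assume \<epsilon>: "\<forall>i<k. \<epsilon> i \<in> {-1, 1}"
  let ?\<mu> = "determinantal_measure n K"
  let ?r = "\<lambda>Y i. (-1 :: real) ^ card (Y \<inter> S i)"
  let ?W = "\<lambda>T. \<Union>i\<in>T. S i"
  define A where "A = {Y \<in> Pow {..<n}. \<forall>i\<in>{..<k}. ?r Y i = \<epsilon> i}"
  have K: "K \<in> carrier_mat n n"
    using assms(1) by (simp add: is_DPP_kernel_def)
  have X: "X \<in> measurable P (count_space (Pow {..<n}))"
    and law: "\<And>B. B \<subseteq> Pow {..<n} \<Longrightarrow> \<P>(\<omega> in P. X \<omega> \<in> B) = ?\<mu> B"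
    using assms(3) by (auto simp: distributed_DPP_def)
  have finS: "finite (S i)" if "i < k" for i
    using assms(5)[OF that] finite_subset by blast
  have indicator: "of_bool (\<forall>i\<in>{..<k}. ?r Y i = \<epsilon> i) =
      1 / 2 ^ k * (\<Sum>T\<in>Pow {..<k}. (\<Prod>i\<in>T. \<epsilon> i) * (-1) ^ card (Y \<inter> ?W T))" for Y
  proof -
    have "(\<Prod>i\<in>T. ?r Y i) = (-1) ^ card (Y \<inter> ?W T)" if T: "T \<in> Pow {..<k}" for T
      using T finS assms(6)
      by (intro prod_minus_one_power_card_Int)
         (auto intro: finite_subset disjoint_family_on_mono)
    moreover have "?r Y i \<in> {-1, 1}" for i
      by (cases "even (card (Y \<inter> S i))") auto
    ultimately show ?thesis
      using of_bool_signs_agree[of "{..<k}" "?r Y" \<epsilon>] \<epsilon> by simp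
  qed
  have "{\<omega> \<in> space P. \<forall>i<k. R i \<omega> = \<epsilon> i} = {\<omega> \<in> space P. X \<omega> \<in> A}"
    using measurable_space[OF X] assms(7) by (auto simp: A_def)
  moreover have "A \<subseteq> Pow {..<n}" by (auto simp: A_def)
  ultimately have "\<P>(\<omega> in P. \<forall>i<k. R i \<omega> = \<epsilon> i) = ?\<mu> A"
    by (simp only: law)
  also have "\<dots> = (\<Sum>Y\<in>A. ?\<mu> {Y})"
    by (rule determinantal_measure_eq_sum_singletons) (auto simp: A_def)
  also have "\<dots> = (\<Sum>Y\<in>Pow {..<n}. ?\<mu> {Y} * of_bool (\<forall>i\<in>{..<k}. ?r Y i = \<epsilon> i))"
    by (rule sum.mono_neutral_cong_left) (auto simp: A_def)
  also have "\<dots> = (\<Sum>Y\<in>Pow {..<n}. \<Sum>T\<in>Pow {..<k}.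
      1 / 2 ^ k * ((\<Prod>i\<in>T. \<epsilon> i) * (?\<mu> {Y} * (-1) ^ card (Y \<inter> ?W T))))"
    unfolding indicator sum_distrib_left by (simp only: mult.left_commute)
  also have "\<dots> = 1 / 2 ^ k * (\<Sum>T\<in>Pow {..<k}. (\<Prod>i\<in>T. \<epsilon> i) *
      (\<Sum>Y\<in>Pow {..<n}. ?\<mu> {Y} * (-1) ^ card (Y \<inter> ?W T)))"
    unfolding sum_distrib_left by (rule sum.swap)
  also have "\<dots> = 1 / 2 ^ k * (\<Sum>T\<in>Pow {..<k}.
      (\<Prod>i\<in>T. \<epsilon> i) * Determinant.det (submatrix M (?W T) (?W T)))"
  proof -
    have "(\<Sum>Y\<in>Pow {..<n}. ?\<mu> {Y} * (-1) ^ card (Y \<inter> ?W T)) =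
        Determinant.det (submatrix M (?W T) (?W T))" if "T \<in> Pow {..<k}" for T
      unfolding assms(4)
      using that assms(5) by (intro determinantal_expectation_parity[OF K]) blast
    then show ?thesis by simp
  qed
  finally show "\<P>(\<omega> in P. \<forall>i<k. R i \<omega> = \<epsilon> i) = 1 / 2 ^ k * (\<Sum>T\<in>Pow {..<k}.
      (\<Prod>i\<in>T. \<epsilon> i) * Determinant.det (submatrix M (?W T) (?W T)))" .
qed

end
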